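(* Let $(\mathcal{L}_n(x))_{n\ge 0}$ be a Lucas-type polynomial sequence determined by $p_0$, $p_1(x)$, $d(x)=\alpha p_1(x)$ and $g(x)$. Let $p>2$ be a prime number and let $T=\{\tau_1,\dots,\tau_{p-1}\}\subset\mathbb{C}$ be the set of roots of $L_p(x)/x$, where $L_p(x)$ is the classical Lucas polynomial. Then the polynomial $\alpha\mathcal{L}_p(x)/d(x)=\mathcal{L}_p(x)/p_1(x)$ is irreducible over $\mathbb{Q}$ if and only if $d(x)^2-g(x)\tau^2$ is irreducible over $\mathbb{Q}(\tau^2)$ for some $\tau\in T$.
   Context: A Lucas-type polynomial sequence is determined by an integer $p_0$ with $|p_0|\in\{1,2\}$ and non-zero polynomials $p_1(x),g(x)\in\mathbb{Z}[x]$; put $\alpha=2/p_0\in\mathbb{Z}$ and $d(x)=\alpha p_1(x)$. Then $\mathcal{L}_0(x)=p_0$, $\mathcal{L}_1(x)=p_1(x)$, and $\mathcal{L}_n(x)=d(x)\mathcal{L}_{n-1}(x)+g(x)\mathcal{L}_{n-2}(x)$ for $n\ge 2$. Standing assumptions: $\gcd(d(x),g(x))=1$, $\deg(g)<\deg(d)$, $\gcd(p_0,p_1(x))=\gcd(p_0,d(x))=\gcd(p_0,g(x))=1$, and $\deg(p_1)\ge 1$, where $\gcd=1$ means that the only common divisors in $\mathbb{Z}[x]$ are $\pm 1$. The classical Lucas polynomials are $L_0(x)=2$, $L_1(x)=x$, $L_n(x)=xL_{n-1}(x)+L_{n-2}(x)$ for $n\ge 2$. *)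

theory Defs
  imports
    "HOL-Algebra.Algebraic_Closure_Type"
    "HOL-Algebra.Generated_Fields"
    "HOL-Computational_Algebra.Computational_Algebra"
    Complex_Main
begin

(* HOL-Algebra reuses these names for its record-based notions; below, the short names
   refer to the type-class versions. *)
hide_const (open) Divisibility.prime Divisibility.irreducible up_ring.coeff up_ring.monom
  module.smult

text \<open>
  The recursion alone makes sense for any parameters; the conditions linking \<open>p0\<close>, \<open>p1\<close>, \<open>d\<close>
  and \<open>g\<close> in a Lucas-type sequence are hypotheses wherever the sequence is used.
\<close>
fun lucas_type :: "int \<Rightarrow> int poly \<Rightarrow> int poly \<Rightarrow> int poly \<Rightarrow> nat \<Rightarrow> int poly" where
  "lucas_type p0 p1 d g 0 = [:p0:]"
| "lucas_type p0 p1 d g (Suc 0) = p1"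
| "lucas_type p0 p1 d g (Suc (Suc n)) =
     d * lucas_type p0 p1 d g (Suc n) + g * lucas_type p0 p1 d g n"

fun lucas :: "nat \<Rightarrow> int poly" where
  "lucas 0 = [:2:]"
| "lucas (Suc 0) = [:0, 1:]"
| "lucas (Suc (Suc n)) = [:0, 1:] * lucas (Suc n) + lucas n"

definition lucas_roots :: "nat \<Rightarrow> complex set" where
  "lucas_roots n = {\<tau>. poly (map_poly of_int (lucas n) div [:0, 1:]) \<tau> = 0}"

text \<open>The simple extension \<open>\<rat>(t)\<close> inside the complex numbers; the prime field is generated by \<open>1\<close>.\<close>
definition rat_adjoin :: "complex \<Rightarrow> complex set" where
  "rat_adjoin t = generate_field (ring_of_type_algebra :: complex ring) {t}"

text \<open>For a subfield \<open>K\<close> of the complex numbers, \<open>K[x]\<close> as a subring of the ring of complex polynomials.\<close>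
definition polys_over :: "complex set \<Rightarrow> complex poly ring" where
  "polys_over K = ring_of_type_algebra \<lparr>carrier := {q. \<forall>i. coeff q i \<in> K}\<rparr>"

definition irreducible_over :: "complex set \<Rightarrow> complex poly \<Rightarrow> bool" where
  "irreducible_over K q \<longleftrightarrow> q \<in> carrier (polys_over K) \<and> ring_irreducible\<^bsub>polys_over K\<^esub> q"

text \<open>The quotients \<open>\<L>\<^sub>n / p\<^sub>1\<close> and \<open>L\<^sub>n / x\<close> are exact for odd \<open>n\<close>, and \<open>\<alpha> \<L>\<^sub>n / d = \<L>\<^sub>n / p\<^sub>1\<close>.\<close>

lemma p1_dvd_lucas_type:
  assumes "odd n" and "p1 dvd d"
  shows "p1 dvd lucas_type p0 p1 d g n"
  using assms by (induction p0 p1 d g n rule: lucas_type.induct) auto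

lemma x_dvd_lucas: "odd n \<Longrightarrow> [:0, 1:] dvd lucas n"
  by (induction n rule: lucas.induct) (auto simp del: mult_pCons_left)

lemma quotient_eq:
  fixes \<alpha> :: int and p1 q :: "int poly"
  assumes "\<alpha> \<noteq> 0"
  shows "(map_poly of_int (smult \<alpha> q) :: rat poly) div map_poly of_int (smult \<alpha> p1) =
         map_poly of_int q div map_poly of_int p1"
proof -
  have *: "(map_poly of_int (smult \<alpha> r) :: rat poly) = smult (of_int \<alpha>) (map_poly of_int r)" for r
    by (rule poly_eqI) (simp add: coeff_map_poly)
  show ?thesis
    using assms by (simp add: * div_smult_left div_smult_right)
qed

end

theory Submission
  imports Defs
begin

text \<open>
  Write \<open>p = 2m + 1\<close>. Then \<open>L\<^sub>p / x = \<Psi>(x\<^sup>2)\<close> with \<open>\<Psi>\<close> monic of degree \<open>m\<close>, and \<open>\<Psi>\<close> is irreducible over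
  \<open>\<rat>\<close> by Eisenstein's criterion at \<open>p\<close>; moreover \<open>\<L>\<^sub>p / p\<^sub>1 = g\<^sup>m \<Psi>(d\<^sup>2 / g)\<close>. Let \<open>s = \<tau>\<^sup>2\<close>, let \<open>\<theta>\<close> be a root of
  \<open>d\<^sup>2 - s g\<close> and \<open>N = 2 deg d\<close>. Since \<open>deg g < N\<close> and \<open>d\<^sup>2\<close>, \<open>g\<close> are coprime, every \<open>G \<in> \<rat>[x]\<close> of degree below
  \<open>m N\<close> is uniquely \<open>\<Sum>\<^sub>j\<^sub><\<^sub>m d\<^bsup>2j\<^esup> g\<^bsup>m-1-j\<^esup> u\<^sub>j\<close> with \<open>deg u\<^sub>j < N\<close>, and
  \<open>G(\<theta>) = g(\<theta>)\<^bsup>m-1\<^esup> U(\<theta>)\<close> for \<open>U = \<Sum>\<^sub>j s\<^sup>j u\<^sub>j\<close>, which runs through all polynomials of degree below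
  \<open>N\<close> over \<open>\<rat>(s)\<close>. So a polynomial of degree below that of \<open>\<L>\<^sub>p / p\<^sub>1\<close> over \<open>\<rat>\<close> kills \<open>\<theta>\<close> iff
  the corresponding one of degree below that of \<open>d\<^sup>2 - s g\<close> over \<open>\<rat>(s)\<close> does; for both polynomials,
  irreducibility means that only \<open>0\<close> does.
\<close>

subsection \<open>Gauss and Eisenstein over the rationals\<close>

lemma map_poly_add_hom:
  assumes "f 0 = 0" "\<And>a b. f (a + b) = f a + f b"
  shows "map_poly f (p + q) = map_poly f p + map_poly f q"
  by (rule poly_eqI) (simp add: coeff_map_poly assms)

lemma map_poly_mult_hom:
  fixes f :: "'a::comm_ring_1 \<Rightarrow> 'b::comm_ring_1"
  assumes "f 0 = 0" "\<And>a b. f (a + b) = f a + f b" "\<And>a b. f (a * b) = f a * f b"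
  shows "map_poly f (p * q) = map_poly f p * map_poly f q"
proof -
  have "f (sum h A) = (\<Sum>x\<in>A. f (h x))" for h :: "nat \<Rightarrow> 'a" and A
    by (induction A rule: infinite_finite_induct) (simp_all add: assms)
  then show ?thesis
    by (intro poly_eqI) (simp add: coeff_map_poly coeff_mult assms)
qed

abbreviation rat_poly :: "int poly \<Rightarrow> rat poly" where "rat_poly \<equiv> map_poly of_int"
abbreviation complex_poly :: "rat poly \<Rightarrow> complex poly" where "complex_poly \<equiv> map_poly of_rat"

lemma rat_poly_add [simp]: "rat_poly (p + q) = rat_poly p + rat_poly q"
  by (rule map_poly_add_hom) simp_all

lemma rat_poly_mult [simp]: "rat_poly (p * q) = rat_poly p * rat_poly q"
  by (rule map_poly_mult_hom) simp_all

lemma rat_poly_power [simp]: "rat_poly (p ^ n) = rat_poly p ^ n"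
  by (induction n) simp_all

lemma rat_poly_diff [simp]: "rat_poly (p - q) = rat_poly p - rat_poly q"
  by (rule poly_eqI) (simp add: coeff_map_poly)

lemma rat_poly_smult [simp]: "rat_poly (smult c p) = smult (of_int c) (rat_poly p)"
  by (rule poly_eqI) (simp add: coeff_map_poly)

lemma degree_rat_poly [simp]: "degree (rat_poly p) = degree p"
  by (rule degree_map_poly) simp

lemma rat_poly_eq_iff [simp]: "rat_poly p = rat_poly q \<longleftrightarrow> p = q"
  by (simp add: poly_eq_iff coeff_map_poly)

lemma rat_poly_eq_0_iff [simp]: "rat_poly p = 0 \<longleftrightarrow> p = 0"
  by (simp add: map_poly_eq_0_iff)

lemma complex_poly_add [simp]: "complex_poly (p + q) = complex_poly p + complex_poly q"
  by (rule map_poly_add_hom) (simp_all add: of_rat_add)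

lemma complex_poly_mult [simp]: "complex_poly (p * q) = complex_poly p * complex_poly q"
  by (rule map_poly_mult_hom) (simp_all add: of_rat_add of_rat_mult)

lemma complex_poly_power [simp]: "complex_poly (p ^ n) = complex_poly p ^ n"
  by (induction n) simp_all

lemma complex_poly_minus [simp]: "complex_poly (- p) = - complex_poly p"
  by (rule poly_eqI) (simp add: coeff_map_poly of_rat_minus)

lemma complex_poly_diff [simp]: "complex_poly (p - q) = complex_poly p - complex_poly q"
  by (rule poly_eqI) (simp add: coeff_map_poly of_rat_diff)

lemma complex_poly_sum: "complex_poly (\<Sum>i\<in>A. f i) = (\<Sum>i\<in>A. complex_poly (f i))"
  by (induction A rule: infinite_finite_induct) simp_all

lemma degree_complex_poly [simp]: "degree (complex_poly p) = degree p"
  by (rule degree_map_poly) simp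

lemma complex_poly_rat_poly: "complex_poly (rat_poly p) = map_poly of_int p"
  by (rule poly_eqI) (simp add: coeff_map_poly)

section \<open>Gauss's lemma and Eisenstein's criterion\<close>

lemma clear_denominators:
  fixes q :: "rat poly"
  obtains c :: int and A :: "int poly" where "c \<noteq> 0" "rat_poly A = smult (of_int c) q"
proof -
  have "\<exists>c A. c \<noteq> 0 \<and> rat_poly A = smult (of_int c) q"
  proof (induction q)
    case 0
    show ?case by (rule exI[of _ 1], rule exI[of _ 0]) simp
  next
    case (pCons a q)
    then obtain c A where cA: "c \<noteq> 0" "rat_poly A = smult (of_int c) q" by auto
    obtain u v :: int where uv: "a = of_int u / of_int v" "v \<noteq> 0"
      by (metis Fract_of_int_quotient Rat_cases less_irrefl)
    have "rat_poly (pCons (c * u) (smult v A)) = smult (of_int (c * v)) (pCons a q)"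
      using cA uv by (simp add: map_poly_pCons mult.commute)
    then show ?case using cA(1) uv(2) by (intro exI[of _ "c * v"] exI[of _ "pCons (c * u) (smult v A)"]) simp
  qed
  then show ?thesis using that by blast
qed

text \<open>Clear the denominators of the rational cofactor and take primitive parts, which are
  multiplicative. \<open>k\<close> is its own primitive part, and the scaling factor
  \<open>e\<close> leaves only a sign behind.\<close>

lemma primitive_dvd_of_rat_poly_dvd:
  assumes "content k = 1" and "rat_poly k dvd rat_poly P"
  shows "k dvd P"
proof -
  obtain B where B: "rat_poly P = rat_poly k * B" using assms(2) by auto
  obtain e B1 where e: "e \<noteq> 0" "rat_poly B1 = smult (of_int e) B"
    by (rule clear_denominators)
  have "rat_poly (smult e P) = rat_poly (k * B1)"
    using B e by simp
  then have "smult e P = k * B1" by (simp only: rat_poly_eq_iff)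
  then have "primitive_part (smult e P) = primitive_part k * primitive_part B1"
    by (simp only: primitive_part_mult)
  then have "k dvd smult (unit_factor e) (primitive_part P)"
    using assms(1) by (simp add: primitive_part_smult primitive_part_prim)
  then have "k dvd primitive_part P"
    using e(1) by (simp add: sgn_if split: if_splits)
  then have "k dvd smult (content P) (primitive_part P)" by (rule dvd_smult)
  then show ?thesis by simp
qed

lemma obtain_primitive_associate:
  fixes A :: "rat poly"
  assumes "A \<noteq> 0"
  obtains k where "content k = 1" "degree k = degree A" "rat_poly k dvd A"
proof -
  obtain c A1 where c: "c \<noteq> 0" "rat_poly A1 = smult (of_int c) A"
    by (rule clear_denominators)
  have A1: "A1 \<noteq> 0" using c assms by auto
  have eq: "smult (of_int c) A = smult (of_int (content A1)) (rat_poly (primitive_part A1))"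
    by (simp only: c(2)[symmetric] rat_poly_smult[symmetric] content_times_primitive_part)
  show ?thesis
  proof (rule that[of "primitive_part A1"])
    show "content (primitive_part A1) = 1" using A1 by simp
    show "degree (primitive_part A1) = degree A"
      using c by (metis degree_primitive_part degree_rat_poly degree_smult_eq of_int_eq_0_iff)
    show "rat_poly (primitive_part A1) dvd A"
      using eq c(1) by (metis dvd_smult_cancel dvd_smult dvd_refl of_int_eq_0_iff)
  qed
qed

text \<open>A common factor over Q has a primitive integer associate, and by Gauss this already
  divides both polynomials in Z[x]. The lemma makes Bezout identities available for \<open>d\<close>
  and \<open>g\<close>, whose coprimality is given over Z only.\<close>

lemma coprime_rat_poly:
  assumes "coprime a b" and "a \<noteq> 0"
  shows "coprime (rat_poly a) (rat_poly b)"
proof (rule coprimeI)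
  fix c assume c: "c dvd rat_poly a" "c dvd rat_poly b"
  then have "c \<noteq> 0" using assms(2) by auto
  then obtain k where k: "content k = 1" "degree k = degree c" "rat_poly k dvd c"
    by (rule obtain_primitive_associate)
  then have "k dvd a" "k dvd b"
    using c primitive_dvd_of_rat_poly_dvd dvd_trans by blast+
  then have "is_unit k" using assms(1) by (meson coprime_common_divisor)
  then have "degree c = 0" using k(2) by (auto simp: is_unit_poly_iff)
  then show "is_unit c" using \<open>c \<noteq> 0\<close> by (simp add: is_unit_iff_degree)
qed

text \<open>Take the least \<open>i\<close> with \<open>coeff A i\<close> not divisible by
  \<open>q\<close>. In coefficient \<open>i\<close> of the product every term except
  \<open>coeff A i * coeff B 0\<close> is divisible by \<open>q\<close>, so \<open>i\<close> cannot
  lie below the degree of \<open>A * B\<close>. As \<open>i\<close> is at most the degree of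
  \<open>A\<close>, \<open>B\<close> must be constant.\<close>

lemma Eisenstein_factor:
  fixes A B :: "int poly"
  assumes q: "Factorial_Ring.prime q"
    and lc: "\<not> q dvd lead_coeff (A * B)"
    and cf: "\<And>i. i < degree (A * B) \<Longrightarrow> q dvd coeff (A * B) i"
    and A0: "q dvd coeff A 0" and B0: "\<not> q dvd coeff B 0"
  shows "degree B = 0"
proof (rule ccontr)
  assume dB: "degree B \<noteq> 0"
  have nz: "A \<noteq> 0" "B \<noteq> 0" using lc by auto
  have "\<not> q dvd lead_coeff A" using lc by (auto simp: lead_coeff_mult)
  then obtain i where i: "\<not> q dvd coeff A i" "i \<le> degree A" "\<And>j. j < i \<Longrightarrow> q dvd coeff A j"
    using exists_least_iff[of "\<lambda>i. \<not> q dvd coeff A i"] by (metis not_le_imp_less)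
  have "coeff (A * B) i = (\<Sum>j\<le>i. coeff A j * coeff B (i - j))"
    by (rule coeff_mult)
  also have "{..i} = insert i {..<i}" by auto
  also have "(\<Sum>j\<in>insert i {..<i}. coeff A j * coeff B (i - j))
      = coeff A i * coeff B 0 + (\<Sum>j<i. coeff A j * coeff B (i - j))"
    by simp
  finally have eq: "coeff (A * B) i = \<dots>" .
  have "q dvd (\<Sum>j<i. coeff A j * coeff B (i - j))"
    using i(3) by (intro dvd_sum) auto
  moreover have "\<not> q dvd coeff A i * coeff B 0"
    using q i(1) B0 by (simp add: prime_dvd_mult_iff)
  ultimately have "\<not> q dvd coeff (A * B) i"
    unfolding eq by (simp add: dvd_add_left_iff)
  moreover have "i < degree (A * B)"
    using i(2) dB nz by (simp add: degree_mult_eq)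
  ultimately show False using cf by blast
qed

text \<open>Gauss turns a factorization over Q into one over Z with the same degrees. Since
  \<open>q\<close> divides the constant coefficient of \<open>P\<close> exactly once, it divides
  that of exactly one factor, and \<open>Eisenstein_factor\<close> makes the other factor
  constant.\<close>

lemma Eisenstein:
  fixes P :: "int poly"
  assumes q: "Factorial_Ring.prime q"
    and dP: "degree P > 0"
    and lc: "\<not> q dvd lead_coeff P"
    and cf: "\<And>i. i < degree P \<Longrightarrow> q dvd coeff P i"
    and c0: "\<not> q\<^sup>2 dvd coeff P 0"
  shows "irreducible (rat_poly P)"
proof (rule irreducibleI)
  show "rat_poly P \<noteq> 0" using dP by auto
  then show "\<not> is_unit (rat_poly P)" using dP by (simp add: is_unit_iff_degree)
next
  fix A B assume AB: "rat_poly P = A * B"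
  have "rat_poly P \<noteq> 0" using dP by auto
  then have nz: "A \<noteq> 0" "B \<noteq> 0" using AB by auto
  obtain k where k: "content k = 1" "degree k = degree A" "rat_poly k dvd A"
    using nz(1) by (rule obtain_primitive_associate)
  have "k dvd P" using k AB by (metis primitive_dvd_of_rat_poly_dvd dvd_mult2)
  then obtain l where l: "P = k * l" by auto
  have nz': "k \<noteq> 0" "l \<noteq> 0" using l dP by auto
  have "degree k + degree l = degree A + degree B"
    using AB l nz nz' by (metis degree_mult_eq degree_rat_poly)
  then have dl: "degree l = degree B" using k(2) by simp
  have c: "coeff P 0 = coeff k 0 * coeff l 0" by (simp add: l coeff_mult)
  have "q dvd coeff k 0 * coeff l 0" using cf[OF dP] c by simp
  then have "q dvd coeff k 0 \<or> q dvd coeff l 0" using q by (simp add: prime_dvd_mult_iff)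
  moreover have "\<not> (q dvd coeff k 0 \<and> q dvd coeff l 0)"
    using c0 c by (auto simp: power2_eq_square mult_dvd_mono)
  ultimately have "degree k = 0 \<or> degree l = 0"
    using Eisenstein_factor[OF q, of k l] Eisenstein_factor[OF q, of l k] lc cf
    unfolding l by (metis mult.commute)
  then show "is_unit A \<or> is_unit B"
    using k(2) dl nz by (simp add: is_unit_iff_degree)
qed

section \<open>Irreducibility over Q as minimality of the degree at a root\<close>

lemma irreducible_rat_dvd_of_common_root:
  fixes F u :: "rat poly"
  assumes "irreducible F" "poly (complex_poly F) \<theta> = 0" "poly (complex_poly u) \<theta> = 0"
  shows "F dvd u"
proof (rule ccontr)
  assume "\<not> F dvd u"
  then have "coprime F u"
    using assms(1) by (simp add: irreducible_imp_prime_elem prime_elem_imp_coprime)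
  \<comment> \<open>A Bezout identity for \<open>F\<close> and \<open>u\<close>, evaluated at the
    common root \<theta>, would read 0 = 1.\<close>
  then have "bezout_coefficients F u = (fst (bezout_coefficients F u), snd (bezout_coefficients F u))"
    by simp
  then have "fst (bezout_coefficients F u) * F + snd (bezout_coefficients F u) * u = 1"
    using bezout_coefficients_fst_snd[of F u] \<open>coprime F u\<close> by simp
  then have "complex_poly (fst (bezout_coefficients F u)) * complex_poly F
      + complex_poly (snd (bezout_coefficients F u)) * complex_poly u = 1"
    by (metis complex_poly_add complex_poly_mult map_poly_1' of_rat_1)
  then have "poly (complex_poly (fst (bezout_coefficients F u)) * complex_poly F
      + complex_poly (snd (bezout_coefficients F u)) * complex_poly u) \<theta> = 1" by simp
  then show False using assms by simp
qed

lemma irreducible_rat_iff_no_smaller: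
  fixes F :: "rat poly"
  assumes "degree F > 0" and root: "poly (complex_poly F) \<theta> = 0"
  shows "irreducible F \<longleftrightarrow>
    (\<forall>u. u \<noteq> 0 \<longrightarrow> poly (complex_poly u) \<theta> = 0 \<longrightarrow> degree F \<le> degree u)"
proof
  assume "irreducible F"
  then show "\<forall>u. u \<noteq> 0 \<longrightarrow> poly (complex_poly u) \<theta> = 0 \<longrightarrow> degree F \<le> degree u"
    using irreducible_rat_dvd_of_common_root root dvd_imp_degree_le by blast
next
  assume *: "\<forall>u. u \<noteq> 0 \<longrightarrow> poly (complex_poly u) \<theta> = 0 \<longrightarrow> degree F \<le> degree u"
  have F: "F \<noteq> 0" using assms(1) by auto
  show "irreducible F"
  proof (rule irreducibleI)
    show "F \<noteq> 0" by fact
    show "\<not> is_unit F" using F assms(1) by (simp add: is_unit_iff_degree)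
    fix a b assume ab: "F = a * b"
    then have nz: "a \<noteq> 0" "b \<noteq> 0" using F by auto
    have "poly (complex_poly a) \<theta> = 0 \<or> poly (complex_poly b) \<theta> = 0"
      using root ab by simp
    then have "degree F \<le> degree a \<or> degree F \<le> degree b" using * nz by blast
    then show "is_unit a \<or> is_unit b"
      using nz ab by (auto simp: is_unit_iff_degree degree_mult_eq)
  qed
qed

subsection \<open>Irreducibility over subfields of the complex numbers\<close>

locale complex_subfield =
  fixes K :: "complex set"
  assumes one: "1 \<in> K"
    and add: "a \<in> K \<Longrightarrow> b \<in> K \<Longrightarrow> a + b \<in> K"
    and minus: "a \<in> K \<Longrightarrow> - a \<in> K"
    and mult: "a \<in> K \<Longrightarrow> b \<in> K \<Longrightarrow> a * b \<in> K"
    and inverse: "a \<in> K \<Longrightarrow> inverse a \<in> K"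
begin

lemma zero: "0 \<in> K"
  using add[OF one minus[OF one]] by simp

lemma diff: "a \<in> K \<Longrightarrow> b \<in> K \<Longrightarrow> a - b \<in> K"
  using add[OF _ minus] by fastforce

lemma sum: "(\<And>i. i \<in> A \<Longrightarrow> f i \<in> K) \<Longrightarrow> sum f A \<in> K"
  by (induction A rule: infinite_finite_induct) (auto simp: zero add)

lemma power: "a \<in> K \<Longrightarrow> a ^ n \<in> K"
  by (induction n) (auto simp: one mult)

lemma of_nat: "of_nat n \<in> K"
  by (induction n) (auto simp: zero one add)

lemma of_int: "of_int n \<in> K"
  by (cases n rule: int_cases2) (auto simp: of_nat minus)

lemma of_rat: "of_rat r \<in> K"
proof -
  obtain u v where "r = of_int u / of_int v"
    by (metis Fract_of_int_quotient Rat_cases)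
  then show ?thesis by (simp add: divide_inverse of_rat_mult of_rat_inverse mult inverse of_int)
qed

definition polys :: "complex poly set" where
  "polys = {q. \<forall>i. coeff q i \<in> K}"

lemma polys_mult: "q \<in> polys \<Longrightarrow> r \<in> polys \<Longrightarrow> q * r \<in> polys"
  by (auto simp: polys_def coeff_mult sum mult)

lemma polys_diff: "q \<in> polys \<Longrightarrow> r \<in> polys \<Longrightarrow> q - r \<in> polys"
  by (auto simp: polys_def diff)

lemma polys_add: "q \<in> polys \<Longrightarrow> r \<in> polys \<Longrightarrow> q + r \<in> polys"
  by (auto simp: polys_def add)

lemma polys_monom: "c \<in> K \<Longrightarrow> monom c n \<in> polys"
  by (auto simp: polys_def zero)

lemma polys_const: "c \<in> K \<Longrightarrow> [:c:] \<in> polys"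
  using polys_monom[of c 0] by (simp add: monom_0)

text \<open>Long division that keeps quotient and remainder inside K[x]: each step divides only by
  the leading coefficient of \<open>u\<close>, whose inverse lies in K.\<close>

lemma polys_division:
  assumes u: "u \<in> polys" "u \<noteq> 0" and h: "h \<in> polys"
  shows "\<exists>q r. q \<in> polys \<and> r \<in> polys \<and> h = q * u + r \<and> (r = 0 \<or> degree r < degree u)"
  using h
\<comment> \<open>The zero polynomial and the nonzero constants share degree 0. The shifted measure
  separates them, so that reducing a constant to 0 also counts as a decrease.\<close>
proof (induction "if h = 0 then 0 else Suc (degree h)" arbitrary: h rule: less_induct)
  case less
  show ?case
  proof (cases "h = 0 \<or> degree h < degree u")
    case True
    have "0 \<in> polys" by (simp add: polys_def zero)
    then show ?thesis using True less.prems by (intro exI[of _ 0] exI[of _ h]) auto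
  next
    case False
    define c where "c = lead_coeff h * inverse (lead_coeff u)"
    define t where "t = monom c (degree h - degree u)"
    have "c \<in> K" using less.prems u(1) by (simp add: c_def polys_def mult inverse)
    then have t: "t \<in> polys" unfolding t_def by (rule polys_monom)
    have h': "h - t * u \<in> polys" using t u(1) less.prems by (simp add: polys_diff polys_mult)
    have c0: "c \<noteq> 0" using False u(2) by (simp add: c_def)
    have dt: "degree (t * u) = degree h"
      using c0 u(2) False by (simp add: t_def degree_mult_eq degree_monom_eq)
    have "lead_coeff (t * u) = lead_coeff h"
      using u(2) c0 by (simp add: t_def lead_coeff_mult degree_monom_eq c_def)
    then have "coeff (h - t * u) (degree h) = 0" using dt by simp
    moreover have "degree (h - t * u) \<le> degree h" by (rule degree_diff_le) (simp_all add: dt)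
    ultimately have "h - t * u = 0 \<or> degree (h - t * u) < degree h"
      by (metis eq_zero_or_degree_less)
    then have "(if h - t * u = 0 then 0 else Suc (degree (h - t * u)))
        < (if h = 0 then 0 else Suc (degree h))"
      using False by auto
    from less.hyps[OF this h'] obtain q r where
      "q \<in> polys" "r \<in> polys" "h - t * u = q * u + r" "r = 0 \<or> degree r < degree u"
      by blast
    then have "q + t \<in> polys" "h = (q + t) * u + r"
      using t by (auto simp: algebra_simps polys_add)
    then show ?thesis using \<open>r \<in> polys\<close> \<open>r = 0 \<or> degree r < degree u\<close> by blast
  qed
qed

lemma Units_polys_over:
  "u \<in> Units (polys_over K) \<longleftrightarrow> u \<in> polys \<and> u \<noteq> 0 \<and> degree u = 0"
proof
  assume "u \<in> Units (polys_over K)"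
  then obtain v where "u \<in> polys" "u * v = 1"
    by (auto simp: Units_def polys_over_def ring_of_type_algebra_def polys_def)
  then show "u \<in> polys \<and> u \<noteq> 0 \<and> degree u = 0"
    using is_unit_iff_degree[of u] by (metis dvdI mult_zero_left zero_neq_one)
next
  assume u: "u \<in> polys \<and> u \<noteq> 0 \<and> degree u = 0"
  then obtain c where c: "u = [:c:]" by (metis degree_eq_zeroE)
  then have "c \<noteq> 0" "c \<in> K" using u by (auto simp: polys_def dest: spec[of _ 0])
  then have "[:inverse c:] \<in> polys" "[:inverse c:] * u = 1" "u * [:inverse c:] = 1"
    using c by (auto simp: polys_const inverse one_pCons)
  then show "u \<in> Units (polys_over K)"
    using u by (auto simp: Units_def polys_over_def ring_of_type_algebra_def polys_def)
qed

text \<open>For nonzero h = u v, comparing degrees shows that h divides u only if v is constant;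
  conversely a nonzero constant v is a unit of K[x]. Hence the proper factors of h are exactly those
  with a nonconstant cofactor, which reduces the ring-theoretic notion to a condition on
  degrees.\<close>

lemma irreducible_over_iff:
  "irreducible_over K h \<longleftrightarrow> h \<in> polys \<and> degree h > 0 \<and>
    (\<forall>u\<in>polys. \<forall>v\<in>polys. h = u * v \<longrightarrow> degree u = 0 \<or> degree v = 0)"
proof -
  have carr: "carrier (polys_over K) = polys"
    by (simp add: polys_over_def polys_def)
  have mul: "x \<otimes>\<^bsub>polys_over K\<^esub> y = x * y" for x y
    by (simp add: polys_over_def ring_of_type_algebra_def)
  have zer: "\<zero>\<^bsub>polys_over K\<^esub> = 0"
    by (simp add: polys_over_def ring_of_type_algebra_def)
  have pf: "properfactor (polys_over K) u h \<longleftrightarrow>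
      (\<exists>v\<in>polys. h = u * v) \<and> \<not> (\<exists>w\<in>polys. u = h * w)" for u
    by (simp add: properfactor_def factor_def carr mul)
  have "(\<forall>u\<in>polys. (\<exists>v\<in>polys. h = u * v) \<and> \<not> (\<exists>w\<in>polys. u = h * w) \<longrightarrow> degree u = 0)
    \<longleftrightarrow> (\<forall>u\<in>polys. \<forall>v\<in>polys. h = u * v \<longrightarrow> degree u = 0 \<or> degree v = 0)" (is "?L \<longleftrightarrow> ?R")
    if h: "h \<in> polys" "h \<noteq> 0"
  proof
    assume L: ?L
    show ?R
    proof (intro ballI impI)
      fix u v assume uv: "u \<in> polys" "v \<in> polys" "h = u * v"
      show "degree u = 0 \<or> degree v = 0"
      proof (cases "\<exists>w\<in>polys. u = h * w")
        case True
        then obtain w where "u = h * w" by auto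
        then have "degree u = degree h + degree w" "degree h = degree u + degree v"
          using uv h by (metis degree_mult_eq mult_eq_0_iff)+
        then show ?thesis by simp
      qed (use L uv in blast)
    qed
  next
    assume R: ?R
    show ?L
    proof (intro ballI impI; elim conjE bexE)
      fix u v assume uv: "u \<in> polys" "\<not> (\<exists>w\<in>polys. u = h * w)" "v \<in> polys" "h = u * v"
      have v0: "v \<noteq> 0" using h uv by auto
      have "degree v \<noteq> 0"
      proof
        assume "degree v = 0"
        then have "v \<in> Units (polys_over K)" using uv v0 by (simp add: Units_polys_over)
        then obtain w where w: "w \<in> polys" "v * w = 1"
          by (auto simp: Units_def polys_over_def ring_of_type_algebra_def polys_def)
        then have "u = h * w" using uv by (simp add: mult.assoc)
        then show False using uv w by blast
      qed
      then show "degree u = 0" using R[rule_format, OF uv(1,3,4)] by simp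
    qed
  qed
  moreover have "(\<forall>u\<in>polys. properfactor (polys_over K) u h \<longrightarrow> u \<in> Units (polys_over K))
    \<longleftrightarrow> (\<forall>u\<in>polys. (\<exists>v\<in>polys. h = u * v) \<and> \<not> (\<exists>w\<in>polys. u = h * w) \<longrightarrow> degree u = 0)"
    if "h \<noteq> 0"
    unfolding pf using that by (intro ball_cong refl imp_cong) (auto simp: Units_polys_over)
  ultimately have iff: "(\<forall>u\<in>polys. properfactor (polys_over K) u h \<longrightarrow> u \<in> Units (polys_over K))
    \<longleftrightarrow> (\<forall>u\<in>polys. \<forall>v\<in>polys. h = u * v \<longrightarrow> degree u = 0 \<or> degree v = 0)"
    if "h \<in> polys" "h \<noteq> 0"
    using that by (simp only: simp_thms)
  show ?thesis
    unfolding irreducible_over_def ring_irreducible_def Divisibility.irreducible_def carr zer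
  proof (cases "h \<in> polys \<and> h \<noteq> 0")
    case True
    then have h: "h \<in> polys" "h \<noteq> 0" by auto
    have "h \<notin> Units (polys_over K) \<longleftrightarrow> degree h > 0"
      using h by (simp add: Units_polys_over)
    then show "(h \<in> polys \<and> h \<noteq> 0 \<and> h \<notin> Units (polys_over K) \<and>
        (\<forall>b\<in>polys. properfactor (polys_over K) b h \<longrightarrow> b \<in> Units (polys_over K))) \<longleftrightarrow>
      (h \<in> polys \<and> degree h > 0 \<and>
        (\<forall>u\<in>polys. \<forall>v\<in>polys. h = u * v \<longrightarrow> degree u = 0 \<or> degree v = 0))"
      using h iff[OF h] by (simp only: simp_thms)
  qed auto
qed

text \<open>The analogue over K of \<open>irreducible_rat_iff_no_smaller\<close>. For the forward
  direction, a nonzero \<open>u\<close> in K[x] of least degree vanishing at \<theta> divides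
  \<open>h\<close>, because the remainder vanishes at \<theta> too. As \<open>u\<close> is not
  constant, irreducibility makes the cofactor constant.\<close>

lemma irreducible_over_iff_no_smaller:
  assumes h: "h \<in> polys" "degree h > 0" "poly h \<theta> = 0"
  shows "irreducible_over K h \<longleftrightarrow>
    (\<forall>u\<in>polys. u \<noteq> 0 \<longrightarrow> poly u \<theta> = 0 \<longrightarrow> degree h \<le> degree u)"
proof
  assume irr: "irreducible_over K h"
  define Q where "Q u \<longleftrightarrow> u \<in> polys \<and> u \<noteq> 0 \<and> poly u \<theta> = 0" for u
  have "Q h" using h by (auto simp: Q_def)
  then obtain u where u: "Q u" "\<And>v. Q v \<Longrightarrow> degree u \<le> degree v"
    using ex_has_least_nat[of Q h degree] by blast
  obtain q r where qr: "q \<in> polys" "r \<in> polys" "h = q * u + r" "r = 0 \<or> degree r < degree u"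
    using polys_division[of u h] u(1) h(1) by (auto simp: Q_def)
  have "poly r \<theta> = 0" using qr(3) u(1) h(3) by (simp add: Q_def)
  then have "r = 0" using u(2)[of r] qr(2,4) unfolding Q_def by linarith
  then have hu: "h = q * u" using qr by simp
  have "degree u \<noteq> 0"
  proof
    assume "degree u = 0"
    then obtain c where "u = [:c:]" by (rule degree_eq_zeroE)
    then show False using u(1) by (simp add: Q_def)
  qed
  then have "degree q = 0"
    using irr[unfolded irreducible_over_iff, THEN conjunct2, THEN conjunct2, rule_format, of q u]
      hu qr(1) u(1) by (simp add: Q_def)
  then have "degree h \<le> degree u" using degree_mult_le[of q u] hu by simp
  then show "\<forall>u\<in>polys. u \<noteq> 0 \<longrightarrow> poly u \<theta> = 0 \<longrightarrow> degree h \<le> degree u"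
    using u(2) le_trans unfolding Q_def by blast
next
  assume *: "\<forall>u\<in>polys. u \<noteq> 0 \<longrightarrow> poly u \<theta> = 0 \<longrightarrow> degree h \<le> degree u"
  have "degree u = 0 \<or> degree v = 0" if uv: "u \<in> polys" "v \<in> polys" "h = u * v" for u v
  proof -
    have nz: "u \<noteq> 0" "v \<noteq> 0" using uv h by auto
    have "poly u \<theta> = 0 \<or> poly v \<theta> = 0" using uv h(3) by simp
    then have "degree h \<le> degree u \<or> degree h \<le> degree v" using * nz uv by blast
    then show ?thesis using nz uv(3) by (auto simp: degree_mult_eq)
  qed
  then show "irreducible_over K h"
    by (intro iffD2[OF irreducible_over_iff] conjI ballI impI h(1,2))
qed

end

section \<open>The field Q(t) and its elements as polynomial expressions in t\<close>

lemma inv_ring_of_type_algebra: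
  fixes h :: "'a :: Fields.field"
  assumes "h \<noteq> 0"
  shows "inv\<^bsub>ring_of_type_algebra\<^esub> h = inverse h"
proof -
  interpret field "ring_of_type_algebra :: 'a ring" by rule
  show ?thesis
    by (rule comm_inv_char) (use assms in \<open>auto simp: ring_of_type_algebra_def\<close>)
qed

lemma a_inv_ring_of_type_algebra:
  fixes h :: "'a :: Fields.field"
  shows "\<ominus>\<^bsub>ring_of_type_algebra\<^esub> h = - h"
proof -
  interpret field "ring_of_type_algebra :: 'a ring" by rule
  show ?thesis
    by (rule minus_equality) (auto simp: ring_of_type_algebra_def)
qed

lemma complex_subfield_rat_adjoin: "complex_subfield (rat_adjoin t)"
proof -
  let ?R = "ring_of_type_algebra :: complex ring"
  have ops: "\<one>\<^bsub>?R\<^esub> = 1" "\<zero>\<^bsub>?R\<^esub> = 0" "x \<oplus>\<^bsub>?R\<^esub> y = x + y" "x \<otimes>\<^bsub>?R\<^esub> y = x * y" for x y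
    by (simp_all add: ring_of_type_algebra_def)
  note [simp] = ops a_inv_ring_of_type_algebra inv_ring_of_type_algebra
  show ?thesis
  proof
    show one: "1 \<in> rat_adjoin t"
      using generate_field.one[of ?R "{t}"] by (simp add: rat_adjoin_def)
    show minus: "- a \<in> rat_adjoin t" if "a \<in> rat_adjoin t" for a
      using generate_field.a_inv[of a ?R "{t}"] that by (simp add: rat_adjoin_def)
    show add: "a + b \<in> rat_adjoin t" if "a \<in> rat_adjoin t" "b \<in> rat_adjoin t" for a b
      using generate_field.eng_add[of a ?R "{t}" b] that by (simp add: rat_adjoin_def)
    show "a * b \<in> rat_adjoin t" if "a \<in> rat_adjoin t" "b \<in> rat_adjoin t" for a b
      using generate_field.eng_mult[of a ?R "{t}" b] that by (simp add: rat_adjoin_def)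
    \<comment> \<open>The generation rule for inverses covers nonzero elements; for
      \<open>a = 0\<close> the inverse is 0 by convention, and 0 = 1 + (-1) is in the field.\<close>
    show "inverse a \<in> rat_adjoin t" if "a \<in> rat_adjoin t" for a
      using generate_field.m_inv[of a ?R "{t}"] that add[OF one minus[OF one]]
      by (cases "a = 0") (simp_all add: rat_adjoin_def)
  qed
qed

lemma generator_in_rat_adjoin: "t \<in> rat_adjoin t"
  by (simp add: rat_adjoin_def generate_field.incl)

lemma rat_adjoin_subset:
  assumes "complex_subfield K" "t \<in> K"
  shows "rat_adjoin t \<subseteq> K"
proof
  interpret complex_subfield K by fact
  let ?R = "ring_of_type_algebra :: complex ring"
  have ops: "\<one>\<^bsub>?R\<^esub> = 1" "\<zero>\<^bsub>?R\<^esub> = 0" "x \<oplus>\<^bsub>?R\<^esub> y = x + y" "x \<otimes>\<^bsub>?R\<^esub> y = x * y" for x y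
    by (simp_all add: ring_of_type_algebra_def)
  note [simp] = ops a_inv_ring_of_type_algebra inv_ring_of_type_algebra
  fix x assume "x \<in> rat_adjoin t"
  then have "x \<in> generate_field ?R {t}" by (simp add: rat_adjoin_def)
  then show "x \<in> K"
    by induction (auto simp: one add minus mult inverse assms(2))
qed

text \<open>The values q(s) with q in Q[x] form a subfield containing s, hence all of Q(s). If q(s)
  is nonzero, then P does not divide q, and the Bezout cofactor of q gives the inverse at s.
  Reduction modulo P gives the degree bound.\<close>

lemma rat_adjoin_algebraic:
  assumes irr: "irreducible P" and root: "poly (complex_poly P) s = 0" and a: "a \<in> rat_adjoin s"
  obtains q where "degree q < degree P" "a = poly (complex_poly q) s"
proof -
  define K where "K = range (\<lambda>q. poly (complex_poly q) s)"
  have "complex_subfield K"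
  proof
    have K: "poly (complex_poly q) s \<in> K" for q by (simp add: K_def)
    show "1 \<in> K" using K[of 1] by simp
    show "a + b \<in> K" if ab: "a \<in> K" "b \<in> K" for a b
    proof -
      obtain q where "a = poly (complex_poly q) s" using ab(1) by (auto simp: K_def)
      moreover obtain r where "b = poly (complex_poly r) s" using ab(2) by (auto simp: K_def)
      ultimately show ?thesis using K[of "q + r"] by simp
    qed
    show "a * b \<in> K" if ab: "a \<in> K" "b \<in> K" for a b
    proof -
      obtain q where "a = poly (complex_poly q) s" using ab(1) by (auto simp: K_def)
      moreover obtain r where "b = poly (complex_poly r) s" using ab(2) by (auto simp: K_def)
      ultimately show ?thesis using K[of "q * r"] by simp
    qed
    show "- a \<in> K" if a: "a \<in> K" for a
    proof -
      obtain q where "a = poly (complex_poly q) s" using a by (auto simp: K_def)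
      then show ?thesis using K[of "- q"] by simp
    qed
    show "inverse a \<in> K" if a: "a \<in> K" for a
    proof (cases "a = 0")
      case False
      obtain q where q: "a = poly (complex_poly q) s" using a by (auto simp: K_def)
      have "\<not> P dvd q" using False q root by auto
      then have "coprime P q"
        using irr by (simp add: irreducible_imp_prime_elem prime_elem_imp_coprime)
      then have "fst (bezout_coefficients P q) * P + snd (bezout_coefficients P q) * q = 1"
        using bezout_coefficients_fst_snd[of P q] by simp
      then have "poly (complex_poly (fst (bezout_coefficients P q) * P + snd (bezout_coefficients P q) * q)) s = 1"
        by simp
      then have "poly (complex_poly (snd (bezout_coefficients P q))) s * a = 1"
        using root q by simp
      then have "inverse a = poly (complex_poly (snd (bezout_coefficients P q))) s"
        using False by (simp add: field_simps)
      then show ?thesis by (auto simp: K_def)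
    qed (use a in simp)
  qed
  moreover have "s \<in> K"
    unfolding K_def by (rule image_eqI[of _ _ "[:0, 1:]"]) (simp_all add: map_poly_pCons)
  ultimately have "a \<in> K" using rat_adjoin_subset a by blast
  then obtain q where q: "a = poly (complex_poly q) s" by (auto simp: K_def)
  have "P \<noteq> 0" using irr by auto
  moreover have "degree P \<noteq> 0" using irr \<open>P \<noteq> 0\<close> is_unit_iff_degree irreducible_not_unit by blast
  ultimately have "degree (q mod P) < degree P"
    using degree_mod_less'[of P q] by (cases "q mod P = 0") auto
  moreover have "poly (complex_poly (q div P * P + q mod P)) s = poly (complex_poly (q mod P)) s"
    using root by (simp only: complex_poly_add complex_poly_mult poly_add poly_mult) simp
  then have "a = poly (complex_poly (q mod P)) s"
    using q by simp
  ultimately show ?thesis by (rule that)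
qed

subsection \<open>Irreducibility of rational compositions\<close>

text \<open>The digit at index 0 is forced modulo \<open>a\<close>, where the power of
  \<open>g\<close> is invertible. Subtracting its term leaves a multiple of \<open>a\<close>, and
  since \<open>degree g < degree a\<close> the quotient is again small enough for the
  induction.\<close>

lemma mixed_radix_expansion:
  fixes a g G :: "'a :: field_gcd poly"
  assumes "coprime a g" and "degree g < degree a" and "degree G < Suc k * degree a"
  shows "\<exists>u. (\<forall>j. degree (u j) < degree a) \<and> G = (\<Sum>j<Suc k. a ^ j * g ^ (k - j) * u j)"
  using assms(3)
proof (induction k arbitrary: G)
  case 0
  then show ?case by (intro exI[of _ "\<lambda>_. G"]) simp
next
  case (Suc k)
  have a0: "a \<noteq> 0" using assms(2) by auto
  \<comment> \<open>\<open>y\<close> is the inverse of \<open>g ^ Suc k\<close> modulo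
    \<open>a\<close>, so \<open>v\<close> below is the residue of \<open>G\<close> divided by that
    power.\<close>
  define x y where "x = fst (bezout_coefficients a (g ^ Suc k))"
    and "y = snd (bezout_coefficients a (g ^ Suc k))"
  have "coprime a (g ^ Suc k)" using assms(1) by (simp only: coprime_power_right_iff) simp
  then have xy: "x * a + y * g ^ Suc k = 1"
    using bezout_coefficients_fst_snd[of a "g ^ Suc k"] by (simp only: x_def y_def coprime_iff_gcd_eq_1)
  define v where "v = (G * y) mod a"
  have dv: "degree v < degree a"
    unfolding v_def using a0 assms(2) by (cases "G * y mod a = 0") (auto dest: degree_mod_less')
  have "G - g ^ Suc k * v = G * (x * a + y * g ^ Suc k) - g ^ Suc k * (G * y - G * y div a * a)"
    by (simp only: xy v_def minus_div_mult_eq_mod) simp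
  also have "\<dots> = a * (G * x + g ^ Suc k * (G * y div a))"
    by (simp only: algebra_simps)
  finally obtain G' where G': "G - g ^ Suc k * v = a * G'" by blast
  have "degree (g ^ Suc k * v) \<le> Suc k * degree g + degree v"
    using degree_mult_le[of "g ^ Suc k" v] degree_power_le[of g "Suc k"]
    by (simp only: mult.commute)
  also have "\<dots> < Suc k * degree a + degree a"
    using dv assms(2) by (intro add_le_less_mono mult_le_mono2) auto
  finally have "degree (a * G') < Suc k * degree a + degree a"
    using Suc.prems unfolding G'[symmetric] by (intro degree_diff_less) (auto simp: add.commute)
  then have "degree G' < Suc k * degree a"
    using a0 dv by (cases "G' = 0") (auto simp: degree_mult_eq)
  from Suc.IH[OF this] obtain u
    where u: "\<And>j. degree (u j) < degree a" "G' = (\<Sum>j<Suc k. a ^ j * g ^ (k - j) * u j)"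
    by blast
  \<comment> \<open>\<open>case_nat v u\<close> prepends \<open>v\<close> as digit 0; the factor
    \<open>a\<close> moves the remaining digits up by one index.\<close>
  have "G = g ^ Suc k * v + a * G'" using G' by (simp add: algebra_simps)
  also have "\<dots> = (\<Sum>j<Suc (Suc k). a ^ j * g ^ (Suc k - j) * case_nat v u j)"
    unfolding u(2) sum_distrib_left
    by (subst (2) sum.lessThan_Suc_shift) (simp del: sum.lessThan_Suc add: mult.assoc)
  finally show ?case using u(1) dv by (intro exI[of _ "case_nat v u"]) (simp split: nat.split)
qed

text \<open>Modulo \<open>a\<close> only the term with index 0 survives. So \<open>a\<close> divides
  the digit \<open>u 0\<close>, which is 0 by its degree; cancelling \<open>a\<close> leaves a
  shorter sum of the same shape.\<close>

lemma mixed_radix_expansion_unique: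
  fixes a g :: "'a :: field_gcd poly"
  assumes "coprime a g" and "\<And>j. degree (u j) < degree a"
    and "(\<Sum>j<m. a ^ j * g ^ (m - 1 - j) * u j) = 0" and "j < m"
  shows "u j = 0"
  using assms(2-4)
proof (induction m arbitrary: u j)
  case (Suc m)
  define S where "S = (\<Sum>j<m. a ^ j * g ^ (m - 1 - j) * u (Suc j))"
  have a0: "a \<noteq> 0" using Suc.prems(1)[of 0] by auto
  have eq: "g ^ m * u 0 + a * S = 0"
    using Suc.prems(2) unfolding S_def sum_distrib_left
    by (subst (asm) sum.lessThan_Suc_shift) (simp add: mult.assoc)
  then have "g ^ m * u 0 = a * (- S)" by (simp add: add_eq_0_iff)
  then have "a dvd g ^ m * u 0" by simp
  then have "a dvd u 0"
    using assms(1) by (simp add: coprime_dvd_mult_right_iff)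
  then have u0: "u 0 = 0" using Suc.prems(1)[of 0] by (meson dvd_imp_degree_le not_le)
  then have "S = 0" using eq a0 by simp
  then have "u (Suc i) = 0" if "i < m" for i
    using Suc.IH[of "\<lambda>j. u (Suc j)" i] Suc.prems(1) that unfolding S_def by simp
  then show ?case using u0 Suc.prems(3) by (cases j) auto
qed simp

text \<open>Intended for F = g^n P(a/g) with n = deg P: at a root \<theta> of \<open>h\<close>,
  a(\<theta>) = s g(\<theta>), so F(\<theta>) = g(\<theta>)^n P(s) = 0. Both irreducibility claims
  become minimality claims at one common root.\<close>

lemma irreducible_rational_composition:
  fixes P F a g :: "rat poly" and s :: complex
  defines "h \<equiv> complex_poly a - smult s (complex_poly g)"
  assumes P: "irreducible P" "poly (complex_poly P) s = 0"
    and ag: "coprime a g" "degree g < degree a"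
    and F: "degree F = degree P * degree a"
      "\<And>\<theta>. poly h \<theta> = 0 \<Longrightarrow> poly (complex_poly F) \<theta> = 0"
  shows "irreducible F \<longleftrightarrow> irreducible_over (rat_adjoin s) h"
proof -
  interpret complex_subfield "rat_adjoin s" by (rule complex_subfield_rat_adjoin)
  define N where "N = degree a"
  have N: "N > 0" using ag(2) by (simp add: N_def)
  have P0: "P \<noteq> 0" using P(1) by auto
  have "degree P \<noteq> 0" using P(1) P0 is_unit_iff_degree irreducible_not_unit by blast
  then obtain k where k: "degree P = Suc k" using not0_implies_Suc by blast
  \<comment> \<open>That is, 1, s, ..., s^k are linearly independent over Q.\<close>
  have independent: "q = 0" if "degree q < Suc k" "poly (complex_poly q) s = 0" for q
    using irreducible_rat_dvd_of_common_root[OF P that(2)] that(1) k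
    by (metis dvd_imp_degree_le not_le)
  have s: "s \<in> rat_adjoin s" by (rule generator_in_rat_adjoin)
  have h_polys: "h \<in> polys"
    by (simp add: h_def polys_def coeff_map_poly diff mult s of_rat)
  have "degree (smult s (complex_poly g)) < degree (complex_poly a)"
    using ag(2) degree_smult_le[of s "complex_poly g"] by simp
  then have dh: "degree h = N"
    unfolding h_def using degree_add_eq_left[of "- smult s (complex_poly g)" "complex_poly a"]
    by (simp add: N_def)
  obtain \<theta> where \<theta>: "poly h \<theta> = 0"
    using fundamental_theorem_of_algebra_alt[of h] dh N
    by (metis degree_pCons_0 less_irrefl)
  have a\<theta>: "poly (complex_poly a) \<theta> = s * poly (complex_poly g) \<theta>"
    using \<theta> by (simp add: h_def)
  \<comment> \<open>Otherwise \<open>a\<close> would vanish at \<theta> as well, against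
    coprimality. This allows the power of g(\<theta>) in \<open>E_\<theta>\<close> to be
    cancelled.\<close>
  have g\<theta>: "poly (complex_poly g) \<theta> \<noteq> 0"
  proof
    assume *: "poly (complex_poly g) \<theta> = 0"
    have "fst (bezout_coefficients a g) * a + snd (bezout_coefficients a g) * g = 1"
      using bezout_coefficients_fst_snd[of a g] ag(1) by simp
    then have "poly (complex_poly (fst (bezout_coefficients a g) * a
        + snd (bezout_coefficients a g) * g)) \<theta> = 1" by simp
    then show False using * a\<theta> by simp
  qed

  \<comment> \<open>\<open>E\<close> and \<open>U\<close> read the same digits: \<open>E\<close> as
    a mixed-radix expansion over Q, \<open>U\<close> as coordinates with respect to 1, s, ..., s^k
    over Q(s).\<close>
  define E where "E u = (\<Sum>j<Suc k. a ^ j * g ^ (k - j) * u j)" for u :: "nat \<Rightarrow> rat poly"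
  define U where "U u = (\<Sum>j<Suc k. smult (s ^ j) (complex_poly (u j)))" for u :: "nat \<Rightarrow> rat poly"
  define small where "small u \<longleftrightarrow> (\<forall>j. degree (u j) < N)" for u :: "nat \<Rightarrow> rat poly"

  have E_\<theta>: "poly (complex_poly (E u)) \<theta> = poly (complex_poly g) \<theta> ^ k * poly (U u) \<theta>" for u
  proof -
    have "poly (complex_poly (E u)) \<theta>
        = (\<Sum>j<Suc k. (s * poly (complex_poly g) \<theta>) ^ j * poly (complex_poly g) \<theta> ^ (k - j)
            * poly (complex_poly (u j)) \<theta>)"
      by (simp only: E_def complex_poly_sum poly_sum complex_poly_mult complex_poly_power
          poly_mult poly_power a\<theta>)
    also have "\<dots> = (\<Sum>j<Suc k. poly (complex_poly g) \<theta> ^ k * (s ^ j * poly (complex_poly (u j)) \<theta>))"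
    proof (rule sum.cong)
      fix j assume "j \<in> {..<Suc k}"
      then have "poly (complex_poly g) \<theta> ^ k
          = poly (complex_poly g) \<theta> ^ j * poly (complex_poly g) \<theta> ^ (k - j)"
        by (simp add: power_add[symmetric])
      then show "(s * poly (complex_poly g) \<theta>) ^ j * poly (complex_poly g) \<theta> ^ (k - j)
            * poly (complex_poly (u j)) \<theta>
          = poly (complex_poly g) \<theta> ^ k * (s ^ j * poly (complex_poly (u j)) \<theta>)"
        by (simp add: power_mult_distrib)
    qed simp
    finally show ?thesis
      by (simp only: U_def poly_sum poly_smult sum_distrib_left)
  qed
  have E_eq_0: "u j = 0" if "small u" "E u = 0" "j < Suc k" for u j
    using mixed_radix_expansion_unique[OF ag(1), of u "Suc k" j] that
    by (simp add: small_def E_def N_def)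
  have E_surj: "\<exists>u. small u \<and> G = E u" if "degree G < Suc k * N" for G
    using mixed_radix_expansion[OF ag, of G k] that by (simp add: small_def E_def N_def)
  have E_degree: "degree (E u) < Suc k * N" if "small u" for u
  proof -
    have "degree (a ^ j * g ^ (k - j) * u j) \<le> k * N + (N - 1)" if "j < Suc k" for j
    proof -
      have "degree (a ^ j) \<le> N * j" by (simp add: degree_power_le N_def)
      moreover have "degree (g ^ (k - j)) \<le> degree g * (k - j)" by (rule degree_power_le)
      then have "degree (g ^ (k - j)) \<le> N * (k - j)"
        using mult_le_mono1[of "degree g" N "k - j"] ag(2) unfolding N_def by linarith
      moreover have "degree (u j) \<le> N - 1" using \<open>small u\<close> by (simp add: small_def less_Suc_eq_le[symmetric] N)
      ultimately have "degree (a ^ j * g ^ (k - j) * u j) \<le> N * j + N * (k - j) + (N - 1)"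
        using degree_mult_le[of "a ^ j * g ^ (k - j)" "u j"] degree_mult_le[of "a ^ j" "g ^ (k - j)"]
        by linarith
      also have "N * j + N * (k - j) = k * N"
        using that by (simp add: add_mult_distrib2[symmetric] mult.commute)
      finally show ?thesis .
    qed
    then have "degree (E u) \<le> k * N + (N - 1)"
      unfolding E_def by (intro degree_sum_le) auto
    then show ?thesis using N by simp
  qed

  \<comment> \<open>Transposition: coefficient \<open>i\<close> of \<open>U u\<close> is the value
    at s of the polynomial formed from the coefficients \<open>i\<close> of all digits, so
    \<open>independent\<close> applies to it.\<close>
  have coeff_U: "coeff (U u) i = poly (complex_poly (\<Sum>j<Suc k. monom (coeff (u j) i) j)) s" for u i
    by (simp only: U_def coeff_sum coeff_smult coeff_map_poly complex_poly_sum poly_sum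
        map_poly_monom of_rat_0 poly_monom mult.commute)
  have U_eq_0: "u j = 0" if "U u = 0" "j < Suc k" for u j
  proof (rule poly_eqI)
    fix i
    define q where "q = (\<Sum>j<Suc k. monom (coeff (u j) i) j)"
    have "degree q \<le> k" unfolding q_def
      by (intro degree_sum_le) (auto intro: order.trans[OF degree_monom_le])
    moreover have "poly (complex_poly q) s = 0" using coeff_U[of u i] that(1) by (simp add: q_def)
    ultimately have "q = 0" using independent by (simp add: less_Suc_eq_le)
    moreover have "coeff q j = (\<Sum>j'<Suc k. if j' = j then coeff (u j') i else 0)"
      unfolding q_def coeff_sum coeff_monom ..
    then have "coeff q j = coeff (u j) i" using that(2) by simp
    ultimately show "coeff (u j) i = coeff 0 i" by simp
  qed
  have U_polys: "U u \<in> polys" for u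
    by (auto simp: U_def polys_def coeff_sum coeff_map_poly
        simp del: sum.lessThan_Suc intro!: sum mult power s of_rat)
  have U_degree: "degree (U u) < N" if "small u" for u
  proof -
    have "degree (U u) \<le> N - 1"
      unfolding U_def using that N
      by (intro degree_sum_le order.trans[OF degree_smult_le])
        (auto simp: small_def less_Suc_eq_le[symmetric])
    then show ?thesis using N by simp
  qed
  have U_surj: "\<exists>u. small u \<and> v = U u" if v: "v \<in> polys" "degree v < N" for v
  proof -
    have "\<forall>i. \<exists>q. degree q < Suc k \<and> coeff v i = poly (complex_poly q) s"
      using v(1) rat_adjoin_algebraic[OF P] unfolding k polys_def by blast
    then obtain q where q: "\<And>i. degree (q i) < Suc k" "\<And>i. coeff v i = poly (complex_poly (q i)) s"
      by metis
    \<comment> \<open>The inverse transposition: digit \<open>j\<close> collects, over all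
      \<open>i\<close>, the coefficient of s^j in coefficient \<open>i\<close> of
      \<open>v\<close>.\<close>
    define u where "u j = (\<Sum>i<N. monom (coeff (q i) j) i)" for j
    have "degree (u j) \<le> N - 1" for j
      unfolding u_def by (intro degree_sum_le) (auto intro: order.trans[OF degree_monom_le])
    then have "small u" unfolding small_def by (metis N Suc_pred less_Suc_eq_le One_nat_def)
    moreover have "v = U u"
    proof (rule poly_eqI)
      fix i
      have cu: "coeff (u j) i = (if i < N then coeff (q i) j else 0)" for j
      proof -
        have "coeff (u j) i = (\<Sum>i'<N. if i' = i then coeff (q i') j else 0)"
          unfolding u_def coeff_sum coeff_monom ..
        then show ?thesis by simp
      qed
      show "coeff v i = coeff (U u) i"
      proof (cases "i < N")
        case True
        have "(\<Sum>j<Suc k. monom (coeff (q i) j) j) = (\<Sum>j\<le>k. monom (coeff (q i) j) j)"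
          by (simp only: lessThan_Suc_atMost)
        also have "\<dots> = q i" using q(1)[of i] by (intro poly_as_sum_of_monoms') simp
        finally show ?thesis using True by (simp only: coeff_U cu if_True q(2))
      next
        case False
        then have "coeff v i = 0" using v(2) by (intro coeff_eq_0) simp
        then show ?thesis using False by (simp add: coeff_U cu)
      qed
    qed
    ultimately show ?thesis by blast
  qed

  have dF: "degree F = Suc k * N" using F(1) k by (simp add: N_def)
  have "irreducible F \<longleftrightarrow>
      (\<forall>G. G \<noteq> 0 \<longrightarrow> poly (complex_poly G) \<theta> = 0 \<longrightarrow> degree F \<le> degree G)"
    using irreducible_rat_iff_no_smaller[of F \<theta>] dF N F(2)[OF \<theta>] by simp
  \<comment> \<open>A counterexample on one side yields one on the other with the same digits
    \<open>u\<close>: \<open>E u\<close> and \<open>U u\<close> vanish at \<theta> together, and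
    each is the zero polynomial only when its digits are.\<close>
  also have "\<dots> \<longleftrightarrow> (\<forall>v\<in>polys. v \<noteq> 0 \<longrightarrow> poly v \<theta> = 0 \<longrightarrow> degree h \<le> degree v)"
  proof (intro iffI ballI allI impI)
    fix v assume *: "\<forall>G. G \<noteq> 0 \<longrightarrow> poly (complex_poly G) \<theta> = 0 \<longrightarrow> degree F \<le> degree G"
      and v: "v \<in> polys" "v \<noteq> 0" "poly v \<theta> = 0"
    show "degree h \<le> degree v"
    proof (rule ccontr)
      assume "\<not> degree h \<le> degree v"
      then obtain u where u: "small u" "v = U u" using U_surj[OF v(1)] dh by (metis not_le)
      then have "E u = 0" using * E_\<theta>[of u] v(3) E_degree[OF u(1)] dF by force
      then have "v = 0" using E_eq_0[OF u(1)] by (simp add: u(2) U_def del: sum.lessThan_Suc)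
      then show False using v(2) by simp
    qed
  next
    fix G assume *: "\<forall>v\<in>polys. v \<noteq> 0 \<longrightarrow> poly v \<theta> = 0 \<longrightarrow> degree h \<le> degree v"
      and G: "G \<noteq> 0" "poly (complex_poly G) \<theta> = 0"
    show "degree F \<le> degree G"
    proof (rule ccontr)
      assume "\<not> degree F \<le> degree G"
      then obtain u where u: "small u" "G = E u" using E_surj[of G] dF by (metis not_le)
      then have "poly (U u) \<theta> = 0" using E_\<theta>[of u] G(2) g\<theta> by simp
      then have "U u = 0" using * U_polys[of u] U_degree[OF u(1)] dh by force
      then have "G = 0" using U_eq_0[of u] by (simp add: u(2) E_def del: sum.lessThan_Suc)
      then show False using G(1) by simp
    qed
  qed
  also have "\<dots> \<longleftrightarrow> irreducible_over (rat_adjoin s) h"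
    using irreducible_over_iff_no_smaller[OF h_polys _ \<theta>] dh N by simp
  finally show ?thesis .
qed

subsection \<open>Lucas-type polynomials\<close>

text \<open>
  With \<open>a = d\<^sup>2\<close> this is \<open>\<L>\<^sub>2\<^sub>k\<^sub>+\<^sub>1 / p\<^sub>1\<close>; it comes from the recursion
  \<open>\<L>\<^sub>n\<^sub>+\<^sub>4 = (d\<^sup>2 + 2g) \<L>\<^sub>n\<^sub>+\<^sub>2 - g\<^sup>2 \<L>\<^sub>n\<close>.
\<close>
fun odd_lucas :: "'a::comm_ring_1 \<Rightarrow> 'a \<Rightarrow> nat \<Rightarrow> 'a" where
  "odd_lucas a g 0 = 1"
| "odd_lucas a g (Suc 0) = a + 3 * g"
| "odd_lucas a g (Suc (Suc k)) = (a + 2 * g) * odd_lucas a g (Suc k) - g\<^sup>2 * odd_lucas a g k"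

text \<open>Scaling by \<alpha> replaces \<open>p1\<close> by \<open>d\<close>, so \<open>d\<close>
  can be factored out of every odd term without dividing.\<close>

lemma lucas_type_odd:
  assumes "\<alpha> * p0 = 2" "d = smult \<alpha> p1"
  shows "smult \<alpha> (lucas_type p0 p1 d g (2 * k + 1)) = d * odd_lucas (d\<^sup>2) g k"
proof (induction k rule: induct_nat_012)
  case 0
  show ?case by (simp add: assms(2))
next
  case 1
  \<comment> \<open>The 3 in \<open>odd_lucas\<close> arises here: 2 g d comes from the initial
    value, as \<alpha> p0 = 2, and g d from the term of index 1.\<close>
  have "smult \<alpha> (lucas_type p0 p1 d g 3) = d * (d * smult \<alpha> p1 + smult (\<alpha> * p0) g) + g * smult \<alpha> p1"
    by (simp add: numeral_3_eq_3 algebra_simps smult_add_right)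
  also have "\<dots> = d * (d * d + smult 2 g) + g * d"
    by (simp only: assms(1)) (simp add: assms(2))
  also have "smult 2 g = 2 * g" by (simp add: numeral_poly)
  also have "d * (d * d + 2 * g) + g * d = d * (d\<^sup>2 + 3 * g)"
    by (simp add: power2_eq_square algebra_simps)
  finally show ?case by (simp add: numeral_3_eq_3)
next
  case (ge2 k)
  let ?L = "lucas_type p0 p1 d g"
  have "?L (Suc (Suc (Suc (Suc n)))) = (d\<^sup>2 + 2 * g) * ?L (Suc (Suc n)) - g\<^sup>2 * ?L n" for n
    by (simp add: algebra_simps power2_eq_square)
  from this[of "2 * k + 1"] have "?L (2 * Suc (Suc k) + 1)
      = (d\<^sup>2 + 2 * g) * ?L (2 * Suc k + 1) - g\<^sup>2 * ?L (2 * k + 1)"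
    by simp
  then have "smult \<alpha> (?L (2 * Suc (Suc k) + 1))
      = (d\<^sup>2 + 2 * g) * smult \<alpha> (?L (2 * Suc k + 1)) - g\<^sup>2 * smult \<alpha> (?L (2 * k + 1))"
    by (simp only: smult_diff_right mult_smult_right)
  then show ?case unfolding ge2 by (simp add: algebra_simps)
qed

lemma lucas_eq_lucas_type: "lucas n = lucas_type 2 [:0, 1:] [:0, 1:] 1 n"
  by (induction n rule: lucas.induct) (simp_all del: mult_pCons_left)

text \<open>Stated for arbitrary maps that respect the ring operations, so that it serves both for
  changing coefficients and for evaluating at a point.\<close>

lemma odd_lucas_hom:
  fixes f :: "'a::comm_ring_1 \<Rightarrow> 'b::comm_ring_1"
  assumes "f 1 = 1" "\<And>x y. f (x + y) = f x + f y" "\<And>x y. f (x - y) = f x - f y"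
    "\<And>x y. f (x * y) = f x * f y"
  shows "f (odd_lucas a g k) = odd_lucas (f a) (f g) k"
proof -
  have [simp]: "f 2 = 2" "f 3 = 3"
    using assms(1,2) by (metis one_add_one, metis numeral_Bit1 numeral_One)
  show ?thesis
    by (induction a g k rule: odd_lucas.induct) (simp_all add: assms power2_eq_square)
qed

text \<open>\<open>odd_lucas a g k\<close> is homogeneous of degree k in \<open>a\<close> and
  \<open>g\<close>. At a root of d^2 - s g this pulls out the power of g and leaves the value at
  s.\<close>

lemma odd_lucas_mult: "odd_lucas (s * g) g k = g ^ k * odd_lucas s 1 k"
  by (induction s g k rule: odd_lucas.induct)
     (simp_all add: algebra_simps power2_eq_square)

lemma lucas_odd: "lucas (2 * k + 1) = [:0, 1:] * odd_lucas ([:0, 1:]\<^sup>2) 1 k"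
  using lucas_type_odd[of 1 2 "[:0, 1:]" "[:0, 1:]" 1 k] by (simp only: lucas_eq_lucas_type smult_1_left)

text \<open>In the recursion the product with \<open>a + 2 * g\<close> dominates, since
  \<open>g\<^sup>2\<close> has degree below twice that of \<open>a\<close>. Degree and leading
  coefficient are proved together because the latter shows that the product is nonzero.\<close>

lemma degree_odd_lucas:
  fixes a g :: "'a::idom poly"
  assumes "degree g < degree a"
  shows "degree (odd_lucas a g k) = k * degree a"
    and "lead_coeff (odd_lucas a g k) = lead_coeff a ^ k"
proof -
  have "degree (odd_lucas a g k) = k * degree a \<and> lead_coeff (odd_lucas a g k) = lead_coeff a ^ k"
  proof (induction k rule: induct_nat_012)
  case 0
  show ?case by simp
next
  case 1
  have "degree (3 * g) < degree a"
    using assms degree_mult_le[of 3 g] by simp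
  then show ?case by (simp add: degree_add_eq_left coeff_eq_0)
next
  case (ge2 k)
  have a0: "a \<noteq> 0" using assms by auto
  have "degree (2 * g) < degree a"
    using assms degree_mult_le[of 2 g] by simp
  then have b: "degree (a + 2 * g) = degree a" "lead_coeff (a + 2 * g) = lead_coeff a"
    by (simp_all add: degree_add_eq_left coeff_eq_0)
  then have b0: "a + 2 * g \<noteq> 0" using assms by auto
  have nz: "odd_lucas a g (Suc k) \<noteq> 0"
    using ge2(2) a0 by (metis leading_coeff_0_iff power_not_zero)
  have d1: "degree ((a + 2 * g) * odd_lucas a g (Suc k)) = Suc (Suc k) * degree a"
    using b b0 nz ge2(2) by (simp add: degree_mult_eq)
  have "degree (g\<^sup>2) \<le> degree g * 2" by (rule degree_power_le)
  then have "degree (g\<^sup>2 * odd_lucas a g k) < Suc (Suc k) * degree a"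
    using degree_mult_le[of "g\<^sup>2" "odd_lucas a g k"] ge2(1) assms by simp
  then have lt: "degree (- (g\<^sup>2 * odd_lucas a g k)) < degree ((a + 2 * g) * odd_lucas a g (Suc k))"
    using d1 by simp
  have eq: "odd_lucas a g (Suc (Suc k)) = (a + 2 * g) * odd_lucas a g (Suc k) + - (g\<^sup>2 * odd_lucas a g k)"
    by simp
  have "lead_coeff ((a + 2 * g) * odd_lucas a g (Suc k)) = lead_coeff a ^ Suc (Suc k)"
    by (simp only: lead_coeff_mult b(2) conjunct2[OF ge2(2)] power_Suc)
  moreover have "degree ((a + 2 * g) * odd_lucas a g (Suc k) + - (g\<^sup>2 * odd_lucas a g k))
      = Suc (Suc k) * degree a"
    using degree_add_eq_left[OF lt] d1 by (simp only:)
  moreover have "coeff ((a + 2 * g) * odd_lucas a g (Suc k) + - (g\<^sup>2 * odd_lucas a g k)) (Suc (Suc k) * degree a)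
      = lead_coeff ((a + 2 * g) * odd_lucas a g (Suc k))"
    using coeff_eq_0[OF lt] by (simp only: coeff_add d1 add_0_right)
  ultimately show ?case unfolding eq by (simp only: simp_thms)
  qed
  then show "degree (odd_lucas a g k) = k * degree a"
    and "lead_coeff (odd_lucas a g k) = lead_coeff a ^ k" by blast+
qed

text \<open>The closed form satisfies the recursion by Pascal's rule applied twice. It supplies the
  coefficients for Eisenstein's criterion.\<close>

lemma coeff_odd_lucas:
  "coeff (odd_lucas [:0, 1 :: int:] 1 k) j
    = int (((k + j) choose (2 * j)) + 2 * ((k + j) choose (2 * j + 1)))"
proof (induction k arbitrary: j rule: induct_nat_012)
  case 0
  show ?case by (cases j) (auto simp: binomial_eq_0)
next
  case 1
  show ?case
  proof (cases j)
    case (Suc i)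
    show ?thesis
    proof (cases i)
      case (Suc l)
      then have "1 + j < 2 * j" using \<open>j = Suc i\<close> by simp
      then show ?thesis using Suc \<open>j = Suc i\<close> by (simp add: numeral_poly coeff_pCons binomial_eq_0)
    qed (simp add: Suc numeral_poly eval_nat_numeral)
  qed (simp add: numeral_poly)
next
  case (ge2 k)
  have eq: "odd_lucas [:0, 1 :: int:] 1 (Suc (Suc k)) = pCons 0 (odd_lucas [:0, 1:] 1 (Suc k))
      + 2 * odd_lucas [:0, 1:] 1 (Suc k) - odd_lucas [:0, 1:] 1 k"
    by (simp add: algebra_simps)
  show ?case
  proof (cases j)
    case 0
    then show ?thesis unfolding eq by (simp add: ge2 numeral_poly)
  next
    case (Suc i)
    \<comment> \<open>With n = k + j, the cases r = 2i and r = 2i + 1 treat the two binomials of the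
      closed form separately.\<close>
    have *: "((n + 2) choose (r + 2)) + (n choose (r + 2)) = (n choose r) + 2 * ((n + 1) choose (r + 2))"
      for n r :: nat
      by simp
    show ?thesis
      unfolding eq using *[of "k + j" "2 * i"] *[of "k + j" "2 * i + 1"]
      by (simp add: ge2 numeral_poly Suc)
  qed
qed

text \<open>Absorption gives (2j+1) C(k+j, 2j+1) = (k-j) C(k+j, 2j), and 2j + 1 + 2(k-j) = 2k + 1.
  For prime 2k + 1 this exposes the divisibility of the coefficients with j < k. For j > k both
  sides are 0.\<close>

lemma odd_lucas_weighted_coeff:
  "(2 * j + 1) * (((k + j) choose (2 * j)) + 2 * ((k + j) choose (2 * j + 1)))
    = (2 * k + 1) * ((k + j) choose (2 * j))"
proof (cases "j \<le> k")
  case True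
  have "(2 * j + 1) * ((k + j) choose (2 * j + 1)) = (k - j) * ((k + j) choose (2 * j))"
    using binomial_absorb_comp[of "k + j" "2 * j"] binomial_absorption[of "2 * j" "k + j"] True
    by simp
  then have "(2 * j + 1) * (((k + j) choose (2 * j)) + 2 * ((k + j) choose (2 * j + 1)))
      = (2 * j + 1 + 2 * (k - j)) * ((k + j) choose (2 * j))"
    by (simp only: algebra_simps)
  also have "2 * j + 1 + 2 * (k - j) = 2 * k + 1" using True by simp
  finally show ?thesis .
qed (simp add: binomial_eq_0)

lemma irreducible_odd_lucas:
  assumes p: "Factorial_Ring.prime (2 * m + 1)" and "m > 0"
  shows "irreducible (rat_poly (odd_lucas [:0, 1:] 1 m))"
proof (rule Eisenstein)
  have deg: "degree (odd_lucas [:0, 1 :: int:] 1 m) = m"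
    "lead_coeff (odd_lucas [:0, 1 :: int:] 1 m) = 1"
    using degree_odd_lucas[of 1 "[:0, 1 :: int:]" m] by (simp, simp only:) simp
  show q: "Factorial_Ring.prime (int (2 * m + 1))" using p by (simp only: prime_nat_int_transfer)
  show "degree (odd_lucas [:0, 1 :: int:] 1 m) > 0" using deg assms(2) by simp
  show "\<not> int (2 * m + 1) dvd lead_coeff (odd_lucas [:0, 1 :: int:] 1 m)"
    using deg(2) q by (metis not_prime_unit)
  \<comment> \<open>The constant coefficient is 1 + 2m, the prime itself.\<close>
  show "\<not> (int (2 * m + 1))\<^sup>2 dvd coeff (odd_lucas [:0, 1 :: int:] 1 m) 0"
  proof
    assume "(int (2 * m + 1))\<^sup>2 dvd coeff (odd_lucas [:0, 1 :: int:] 1 m) 0"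
    then have "int (2 * m + 1) * int (2 * m + 1) dvd int (2 * m + 1) * 1"
      by (simp add: coeff_odd_lucas power2_eq_square)
    then have "int (2 * m + 1) dvd 1" using q by (subst (asm) dvd_mult_cancel_left) auto
    then show False using q by (simp only: not_prime_unit)
  qed
  fix j assume "j < degree (odd_lucas [:0, 1 :: int:] 1 m)"
  then have j: "j < m" by (simp only: deg)
  let ?c = "((m + j) choose (2 * j)) + 2 * ((m + j) choose (2 * j + 1))"
  have "2 * m + 1 dvd (2 * j + 1) * ?c"
    unfolding odd_lucas_weighted_coeff by (rule dvd_triv_left)
  then have "2 * m + 1 dvd 2 * j + 1 \<or> 2 * m + 1 dvd ?c"
    using p by (simp only: prime_dvd_mult_iff)
  \<comment> \<open>For j < m the positive number 2j + 1 is smaller than the prime, so it is not a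
    multiple of it.\<close>
  then have "2 * m + 1 dvd ?c" using j by (auto dest: dvd_imp_le)
  then show "int (2 * m + 1) dvd coeff (odd_lucas [:0, 1 :: int:] 1 m) j"
    unfolding coeff_odd_lucas by (simp only: int_dvd_int_iff)
qed

lemma lucas_roots_odd: "lucas_roots (2 * k + 1) = {\<tau>. odd_lucas (\<tau>\<^sup>2) 1 k = 0}"
proof -
  have "(map_poly of_int (lucas (2 * k + 1)) :: complex poly)
      = [:0, 1:] * map_poly of_int (odd_lucas ([:0, 1:]\<^sup>2) 1 k)"
    unfolding lucas_odd by (subst map_poly_mult_hom) (simp_all add: map_poly_pCons)
  also have "map_poly of_int (odd_lucas ([:0, 1:]\<^sup>2) 1 k)
      = odd_lucas ([:0, 1 :: complex:]\<^sup>2) 1 k"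
    by (subst odd_lucas_hom[where f = "map_poly of_int"])
      (auto simp: map_poly_add_hom map_poly_mult_hom map_poly_pCons power2_eq_square
        intro!: poly_eqI simp: coeff_map_poly)
  finally have "map_poly of_int (lucas (2 * k + 1)) div [:0, 1:] = odd_lucas ([:0, 1 :: complex:]\<^sup>2) 1 k"
    by (simp only: nonzero_mult_div_cancel_left pCons_eq_0_iff one_neq_zero simp_thms)
  moreover have "poly (odd_lucas ([:0, 1 :: complex:]\<^sup>2) 1 k) \<tau> = odd_lucas (\<tau>\<^sup>2) 1 k" for \<tau>
    using odd_lucas_hom[of "\<lambda>q. poly q \<tau>" "[:0, 1:]\<^sup>2" 1 k] by simp
  ultimately show ?thesis by (simp add: lucas_roots_def)
qed

theorem theorem4p10:
  fixes p0 \<alpha> :: int and p1 d g :: "int poly" and p :: nat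
  assumes "\<bar>p0\<bar> \<in> {1, 2}"
    and "p1 \<noteq> 0" and "g \<noteq> 0"
    and "\<alpha> = 2 div p0" and "d = smult \<alpha> p1"
    and "coprime d g" and "degree g < degree d"
    and "coprime [:p0:] p1" and "coprime [:p0:] d" and "coprime [:p0:] g"
    and "degree p1 \<ge> 1"
    and "prime p" and "p > 2"
  shows "irreducible
           (map_poly of_int (smult \<alpha> (lucas_type p0 p1 d g p)) div map_poly of_int d :: rat poly)
         \<longleftrightarrow>
         (\<exists>\<tau>\<in>lucas_roots p. irreducible_over (rat_adjoin (\<tau>\<^sup>2))
            ((map_poly of_int d)\<^sup>2 - smult (\<tau>\<^sup>2) (map_poly of_int g)))"
proof -
  have "odd p" using assms(12,13) prime_odd_nat by blast
  then obtain m where m: "p = 2 * m + 1" by (elim oddE)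
  then have "m > 0" using assms(13) by simp
  have d0: "d \<noteq> 0" using assms(7) by auto
  have \<alpha>: "\<alpha> * p0 = 2"
  proof -
    have "p0 = 1 \<or> p0 = 2 \<or> p0 = - 1 \<or> p0 = - 2" using assms(1) by auto
    then show ?thesis using assms(4) by auto
  qed
  define F where "F = rat_poly (odd_lucas (d\<^sup>2) g m)"
  define a where "a = rat_poly (d\<^sup>2)"
  define P where "P = rat_poly (odd_lucas [:0, 1:] 1 m)"
  have quotient: "rat_poly (smult \<alpha> (lucas_type p0 p1 d g p)) div rat_poly d = F"
    using d0 unfolding m lucas_type_odd[OF \<alpha> assms(5)] F_def by simp
  have dd: "degree (d\<^sup>2) = 2 * degree d" using d0 by (simp add: degree_power_eq)
  then have ga: "degree (rat_poly g) < degree a" using assms(7) unfolding a_def degree_rat_poly dd by simp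
  have cop: "coprime a (rat_poly g)"
    using coprime_rat_poly[OF assms(6) d0] by (simp add: a_def)
  have irr: "irreducible P"
    unfolding P_def by (rule irreducible_odd_lucas) (use assms(12) m \<open>m > 0\<close> in auto)
  have degP: "degree P = m"
    unfolding P_def using degree_odd_lucas[of 1 "[:0, 1 :: int:]" m] by simp
  have degF: "degree F = degree P * degree a"
    unfolding degP F_def a_def degree_rat_poly
    by (rule degree_odd_lucas(1)) (use assms(7) dd in simp)
  have eval_int: "poly (complex_poly (rat_poly (odd_lucas b c k))) z
      = odd_lucas (poly (complex_poly (rat_poly b)) z) (poly (complex_poly (rat_poly c)) z) k" for b c k z
    by (subst odd_lucas_hom[where f = "\<lambda>q. poly (complex_poly (rat_poly q)) z"]) simp_all
  \<comment> \<open>The equivalence holds for every root \<tau>, so the existential in the theorem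
    only needs the root set to be nonempty.\<close>
  have key: "irreducible F \<longleftrightarrow> irreducible_over (rat_adjoin (\<tau>\<^sup>2))
      (complex_poly a - smult (\<tau>\<^sup>2) (complex_poly (rat_poly g)))" if "\<tau> \<in> lucas_roots p" for \<tau>
  proof (rule irreducible_rational_composition[OF irr _ cop ga degF])
    have root: "odd_lucas (\<tau>\<^sup>2) 1 m = 0"
      using that unfolding m lucas_roots_odd by simp
    then show "poly (complex_poly P) (\<tau>\<^sup>2) = 0"
      unfolding P_def eval_int by (simp add: map_poly_pCons)
    fix \<theta> assume "poly (complex_poly a - smult (\<tau>\<^sup>2) (complex_poly (rat_poly g))) \<theta> = 0"
    then have "poly (complex_poly a) \<theta> = \<tau>\<^sup>2 * poly (complex_poly (rat_poly g)) \<theta>" by simp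
    then show "poly (complex_poly F) \<theta> = 0"
      unfolding F_def eval_int a_def by (simp only: odd_lucas_mult root) simp
  qed
  \<comment> \<open>Nonemptiness of the root set: \<open>P\<close> has a complex root
    \<open>s\<close>, and a square root of \<open>s\<close> is a root of L_p / x.\<close>
  have "degree (complex_poly P) \<noteq> 0" using degP \<open>m > 0\<close> by simp
  then obtain s where s: "poly (complex_poly P) s = 0"
    using fundamental_theorem_of_algebra_alt[of "complex_poly P"] by (metis degree_pCons_0)
  have "csqrt s \<in> lucas_roots p"
    using s unfolding m lucas_roots_odd P_def eval_int by (simp add: map_poly_pCons)
  then show ?thesis
    using key unfolding quotient a_def rat_poly_power complex_poly_power complex_poly_rat_poly
    by blast
qed

end
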